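(* Let a fixed tolerance vector $\varepsilon=(\varepsilon_{ij}:(i,j)\in\mathcal{W})\in\mathbb{R}_+^{|\mathcal{W}|}$ be given, and define for $h\in\Lambda$, $(i,j)\in\mathcal{W}$, $p\in\mathcal{P}_{ij}$, $t\in[t_0,t_f]$ $$\phi_p^{\varepsilon}(t,h)=\max\left\{\Psi_p(t,h),\ v_{ij}(h)+\varepsilon_{ij}\right\}.$$ Then $h^*\in\Lambda$ is a BR-DUE associated with $\varepsilon$ if and only if $$\sum_{p\in\mathcal{P}}\int_{t_0}^{t_f}\phi_p^{\varepsilon}(t,h^* )\,\big(h_p(t)-h_p^*(t)\big)\,dt\ \ge\ 0\qquad\text{for all } h\in\Lambda .$$
   Context: $[t_0,t_f]\subset\mathbb{R}$ is a compact time interval; $\mathcal{W}$ is a finite set of origin-destination (O-D) pairs; $\mathcal{P}$ is the finite set of paths, the disjoint union of the nonempty sets $\mathcal{P}_{ij}$ of paths connecting $(i,j)\in\mathcal{W}$. $\mathbb{R}_+$ (resp. $\mathbb{R}_{++}$) denotes the nonnegative (resp. positive) reals; $L^2_+[t_0,t_f]$ is the set of nonnegative functions in $L^2[t_0,t_f]$. For given demands $Q_{ij}\in\mathbb{R}_{++}$, the feasible set is $$\Lambda=\Big\{h=(h_p)_{p\in\mathcal{P}}\in\big(L_+^2[t_0,t_f]\big)^{|\mathcal{P}|}:\ \sum_{p\in\mathcal{P}_{ij}}\int_{t_0}^{t_f}h_p(t)\,dt=Q_{ij}\ \ \forall (i,j)\in\mathcal{W}\Big\}.$$ The path delay operator assigns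 to each $h$ the vector of path travel times $D(h)=(D_p(\cdot,h))_{p\in\mathcal{P}}\in(L^2_+[t_0,t_f])^{|\mathcal{P}|}$. The effective path delay operator $\Psi$ assigns to $h$ the vector $\Psi(h)=(\Psi_p(\cdot,h))_{p\in\mathcal{P}}\in(L_+^2[t_0,t_f])^{|\mathcal{P}|}$ with $\Psi_p(t,h)=D_p(t,h)+f(t+D_p(t,h)-T_A)$, where $f$ is a nonnegative arrival penalty function and $T_A$ is the desired arrival time (possibly depending on the O-D pair). Standing assumption: each $\Psi_p(\cdot,h)$ is measurable, positive almost everywhere and square integrable, and its essential infimum is positive. Define $$v_p(h)=\operatorname*{ess\,inf}_{t\in[t_0,t_f]}\Psi_p(t,h)>0,\qquad v_{ij}(h)=\min_{p\in\mathcal{P}_{ij}}v_p(h).$$ Definition (BR-DUE: boundedly rational dynamic user equilibrium). $h^*\in\Lambda$ is a BR-DUE associated with $\varepsilon$ if for all $(i,j)\in\mathcal{W}$ and $p\in\mathcal{P}_{ij}$, for almost every $t\in[t_0,t_f]$, $$h_p^*(t)>0\ \Longrightarrow\ \Psi_p(t,h^* )\in[v_{ij}(h^* ),\,v_{ij}(h^* )+\varepsilon_{ij}].$$ *)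

theory Defs
  imports "HOL-Analysis.Analysis" "HOL-Probability.Essential_Supremum"
begin

text \<open>
  Elements of \<open>L\<^sup>2[a,b]\<close> are represented by real functions, considered up to equality almost
  everywhere on \<open>[a,b]\<close> with respect to Lebesgue measure. Accordingly, nonnegativity is required
  almost everywhere.
\<close>

definition L2 :: "real \<Rightarrow> real \<Rightarrow> (real \<Rightarrow> real) set" where
  "L2 a b = {g \<in> borel_measurable (lebesgue_on {a..b}).
     integrable (lebesgue_on {a..b}) (\<lambda>t. (g t)\<^sup>2)}"

definition L2_plus :: "real \<Rightarrow> real \<Rightarrow> (real \<Rightarrow> real) set" where
  "L2_plus a b = {g \<in> L2 a b. AE t in lebesgue_on {a..b}. 0 \<le> g t}"

text \<open>The values are taken in \<open>ereal\<close>, where the essential infimum always exists.\<close>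

definition essinf :: "'a measure \<Rightarrow> ('a \<Rightarrow> real) \<Rightarrow> ereal" where
  "essinf M g = - esssup M (\<lambda>x. - ereal (g x))"

text \<open>
  \<open>W\<close> is the set of origin-destination pairs and \<open>paths w\<close> the set of paths connecting \<open>w\<close>.
  Path flows and delays are families indexed by a type of paths; only the components in
  \<open>all_paths W paths\<close> are meaningful.
\<close>

definition all_paths :: "('n \<times> 'n) set \<Rightarrow> ('n \<times> 'n \<Rightarrow> 'p set) \<Rightarrow> 'p set" where
  "all_paths W paths = (\<Union>w\<in>W. paths w)"

text \<open>Well defined on \<open>all_paths W paths\<close> when the sets \<open>paths w\<close> are disjoint.\<close>

definition od_pair :: "('n \<times> 'n) set \<Rightarrow> ('n \<times> 'n \<Rightarrow> 'p set) \<Rightarrow> 'p \<Rightarrow> 'n \<times> 'n" where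
  "od_pair W paths p = (THE w. w \<in> W \<and> p \<in> paths w)"

definition feasible_set ::
  "real \<Rightarrow> real \<Rightarrow> ('n \<times> 'n) set \<Rightarrow> ('n \<times> 'n \<Rightarrow> 'p set) \<Rightarrow> ('n \<times> 'n \<Rightarrow> real)
    \<Rightarrow> ('p \<Rightarrow> real \<Rightarrow> real) set" where
  "feasible_set t0 tf W paths Q =
    {h. (\<forall>p\<in>all_paths W paths. h p \<in> L2_plus t0 tf) \<and>
        (\<forall>w\<in>W. (\<Sum>p\<in>paths w. \<integral>t. h p t \<partial>lebesgue_on {t0..tf}) = Q w)}"

definition effective_delay ::
  "('n \<times> 'n) set \<Rightarrow> ('n \<times> 'n \<Rightarrow> 'p set) \<Rightarrow> (real \<Rightarrow> real) \<Rightarrow> ('n \<times> 'n \<Rightarrow> real)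
    \<Rightarrow> (('p \<Rightarrow> real \<Rightarrow> real) \<Rightarrow> 'p \<Rightarrow> real \<Rightarrow> real)
    \<Rightarrow> ('p \<Rightarrow> real \<Rightarrow> real) \<Rightarrow> 'p \<Rightarrow> real \<Rightarrow> real" where
  "effective_delay W paths f TA D h p t =
     D h p t + f (t + D h p t - TA (od_pair W paths p))"

text \<open>
  Below, \<open>\<Psi> h p t\<close> is the effective delay on path \<open>p\<close> at departure time \<open>t\<close> under the flow \<open>h\<close>.
  The conversion to \<open>real\<close> is harmless where the essential infimum is finite, which holds for real
  functions that are nonnegative almost everywhere on a nondegenerate interval.
\<close>

definition v_path ::
  "real \<Rightarrow> real \<Rightarrow> (('p \<Rightarrow> real \<Rightarrow> real) \<Rightarrow> 'p \<Rightarrow> real \<Rightarrow> real)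
    \<Rightarrow> ('p \<Rightarrow> real \<Rightarrow> real) \<Rightarrow> 'p \<Rightarrow> real" where
  "v_path t0 tf \<Psi> h p = real_of_ereal (essinf (lebesgue_on {t0..tf}) (\<Psi> h p))"

definition v_od ::
  "real \<Rightarrow> real \<Rightarrow> ('n \<times> 'n \<Rightarrow> 'p set) \<Rightarrow> (('p \<Rightarrow> real \<Rightarrow> real) \<Rightarrow> 'p \<Rightarrow> real \<Rightarrow> real)
    \<Rightarrow> ('p \<Rightarrow> real \<Rightarrow> real) \<Rightarrow> 'n \<times> 'n \<Rightarrow> real" where
  "v_od t0 tf paths \<Psi> h w = Min (v_path t0 tf \<Psi> h ` paths w)"

definition BR_DUE ::
  "real \<Rightarrow> real \<Rightarrow> ('n \<times> 'n) set \<Rightarrow> ('n \<times> 'n \<Rightarrow> 'p set) \<Rightarrow> ('n \<times> 'n \<Rightarrow> real)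
    \<Rightarrow> (('p \<Rightarrow> real \<Rightarrow> real) \<Rightarrow> 'p \<Rightarrow> real \<Rightarrow> real) \<Rightarrow> ('n \<times> 'n \<Rightarrow> real)
    \<Rightarrow> ('p \<Rightarrow> real \<Rightarrow> real) \<Rightarrow> bool" where
  "BR_DUE t0 tf W paths Q \<Psi> \<epsilon> h \<longleftrightarrow>
     h \<in> feasible_set t0 tf W paths Q \<and>
     (\<forall>w\<in>W. \<forall>p\<in>paths w. AE t in lebesgue_on {t0..tf}.
        h p t > 0 \<longrightarrow>
        \<Psi> h p t \<in> {v_od t0 tf paths \<Psi> h w .. v_od t0 tf paths \<Psi> h w + \<epsilon> w})"

definition phi_eps ::
  "real \<Rightarrow> real \<Rightarrow> ('n \<times> 'n) set \<Rightarrow> ('n \<times> 'n \<Rightarrow> 'p set)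
    \<Rightarrow> (('p \<Rightarrow> real \<Rightarrow> real) \<Rightarrow> 'p \<Rightarrow> real \<Rightarrow> real) \<Rightarrow> ('n \<times> 'n \<Rightarrow> real)
    \<Rightarrow> ('p \<Rightarrow> real \<Rightarrow> real) \<Rightarrow> 'p \<Rightarrow> real \<Rightarrow> real" where
  "phi_eps t0 tf W paths \<Psi> \<epsilon> h p t =
     (let w = od_pair W paths p in max (\<Psi> h p t) (v_od t0 tf paths \<Psi> h w + \<epsilon> w))"

end

theory Submission
  imports Defs
begin

text \<open>
  Write \<open>u\<close> for \<open>v\<^sub>w + \<epsilon>\<^sub>w\<close>, a lower bound of \<open>\<phi>\<^sub>p\<close> on every path \<open>p\<close> of the pair \<open>w\<close>. A flow is a
  BR-DUE iff it only uses departure times with \<open>\<phi>\<^sub>p = u\<close>, that is, iff \<open>(\<phi>\<^sub>p - u) h\<^sub>p = 0\<close> a.e.; it then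
  has the least possible cost \<open>u Q\<^sub>w\<close>. Conversely, the whole demand of \<open>w\<close> can be moved to a
  path attaining the minimum \<open>v\<^sub>w\<close>, spread uniformly over a set of positive measure where its delay is
  below \<open>u + \<delta>\<close>. The variational inequality for this competitor gives
  \<open>\<Sum>\<^sub>p \<integral> (\<phi>\<^sub>p - u) h\<^sub>p \<le> \<delta> Q\<^sub>w\<close>, and \<open>\<delta>\<close> is arbitrary.
\<close>

section \<open>Essential infimum\<close>

lemma essinf_AE_le: "AE x in M. essinf M g \<le> ereal (g x)"
proof -
  have "AE x in M. - ereal (g x) \<le> esssup M (\<lambda>x. - ereal (g x))"
    by (rule esssup_AE)
  then show ?thesis
    unfolding essinf_def by eventually_elim (simp add: ereal_uminus_le_reorder)
qed

lemma essinf_greatest: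
  assumes "g \<in> borel_measurable M" "AE x in M. c \<le> g x"
  shows "ereal c \<le> essinf M g"
proof -
  have "esssup M (\<lambda>x. - ereal (g x)) \<le> - ereal c"
    using assms by (intro esssup_I) auto
  then show ?thesis
    unfolding essinf_def by (metis ereal_minus_le_minus ereal_uminus_uminus)
qed

text \<open>Positivity rules out minus infinity. The value plus infinity would lie below the real
  number \<open>g x\<close> for almost every \<open>x\<close>, which is possible only on a null
  space.\<close>

lemma essinf_eq_real:
  assumes pos: "essinf M g > 0" and M: "emeasure M (space M) \<noteq> 0"
  shows "essinf M g = ereal (real_of_ereal (essinf M g))"
proof -
  have "essinf M g \<noteq> \<infinity>"
  proof
    assume "essinf M g = \<infinity>"
    then have "AE x in M. False"
      using essinf_AE_le[of M g] by simp
    then show False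
      using M by (simp add: trivial_limit_def flip: ae_filter_eq_bot_iff)
  qed
  with pos show ?thesis
    by (simp add: ereal_real)
qed

text \<open>If the sublevel set were null, \<open>c\<close> would be an almost everywhere lower
  bound of \<open>g\<close> and hence at most its essential infimum. This provides the departure
  times to which the competitor flow is moved.\<close>

lemma measure_sublevel_pos:
  fixes g :: "'a \<Rightarrow> real"
  assumes fin: "finite_measure M" and g[measurable]: "g \<in> borel_measurable M" and lt: "essinf M g < ereal c"
  shows "measure M {x \<in> space M. g x < c} > 0"
proof -
  interpret finite_measure M by fact
  have "\<not> (AE x in M. c \<le> g x)"
    using essinf_greatest[OF g] lt by (auto simp: not_less[symmetric])
  then have "emeasure M {x \<in> space M. \<not> c \<le> g x} \<noteq> 0"
    by (subst (asm) AE_iff_measurable[OF _ refl]) auto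
  then show ?thesis
    by (simp add: not_le emeasure_eq_measure zero_less_measure_iff)
qed

section \<open>Square integrable functions on a compact interval\<close>

lemma integrable_mult_L2:
  assumes "f \<in> L2 a b" "g \<in> L2 a b"
  shows "integrable (lebesgue_on {a..b}) (\<lambda>t. f t * g t)"
proof (rule Bochner_Integration.integrable_bound)
  show "integrable (lebesgue_on {a..b}) (\<lambda>t. (f t)\<^sup>2 + (g t)\<^sup>2)"
    using assms by (auto simp: L2_def)
  show "(\<lambda>t. f t * g t) \<in> borel_measurable (lebesgue_on {a..b})"
    using assms by (auto simp: L2_def)
  have "norm (x * y) \<le> norm (x\<^sup>2 + y\<^sup>2)" for x y :: real
  proof -
    have "2 * (\<bar>x\<bar> * \<bar>y\<bar>) \<le> x\<^sup>2 + y\<^sup>2"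
      using sum_squares_bound[of "\<bar>x\<bar>" "\<bar>y\<bar>"] by simp
    moreover have "0 \<le> \<bar>x\<bar> * \<bar>y\<bar>" by simp
    ultimately have "\<bar>x\<bar> * \<bar>y\<bar> \<le> x\<^sup>2 + y\<^sup>2" by linarith
    then show ?thesis by (simp add: abs_mult)
  qed
  then show "AE t in lebesgue_on {a..b}. norm (f t * g t) \<le> norm ((f t)\<^sup>2 + (g t)\<^sup>2)"
    by simp
qed

lemma finite_measure_lebesgue_on_Icc: "finite_measure (lebesgue_on {a..b::real})"
  by (intro finite_measure_lebesgue_on) auto

lemma L2_const: "(\<lambda>t. c) \<in> L2 a b"
  by (simp add: L2_def finite_measure.integrable_const[OF finite_measure_lebesgue_on_Icc])

text \<open>The maximum is one of \<open>f t\<close> and \<open>c\<close>, so its square is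
  dominated by the sum of both squares; constants are integrable because the interval has finite
  measure.\<close>

lemma L2_max_const:
  assumes "f \<in> L2 a b"
  shows "(\<lambda>t. max (f t) c) \<in> L2 a b"
proof -
  have [measurable]: "f \<in> borel_measurable (lebesgue_on {a..b})"
    and "integrable (lebesgue_on {a..b}) (\<lambda>t. (f t)\<^sup>2)"
    using assms by (auto simp: L2_def)
  moreover have "integrable (lebesgue_on {a..b}) (\<lambda>t. (max (f t) c)\<^sup>2)"
  proof (rule Bochner_Integration.integrable_bound)
    show "integrable (lebesgue_on {a..b}) (\<lambda>t. (f t)\<^sup>2 + c\<^sup>2)"
      using assms L2_const[of c a b] by (auto simp: L2_def)
    show "AE t in lebesgue_on {a..b}. norm ((max (f t) c)\<^sup>2) \<le> norm ((f t)\<^sup>2 + c\<^sup>2)"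
      by (simp add: max_def)
  qed measurable
  ultimately show ?thesis by (simp add: L2_def)
qed

lemma L2_plus_indicator:
  assumes "B \<in> sets (lebesgue_on {a..b})" "c \<ge> 0"
  shows "(\<lambda>t. c * indicator B t) \<in> L2_plus a b"
proof -
  interpret finite_measure "lebesgue_on {a..b}"
    by (rule finite_measure_lebesgue_on_Icc)
  have "(\<lambda>t. (c * indicator B t)\<^sup>2) = (\<lambda>t. c\<^sup>2 * indicator B t :: real)"
    by (auto simp: indicator_def)
  then show ?thesis
    using assms by (auto simp: L2_plus_def L2_def emeasure_eq_measure intro!: integrable_real_indicator)
qed

section \<open>Paths grouped by origin-destination pair\<close>

lemma od_pair_eq:
  assumes "disjoint_family_on paths W" "w \<in> W" "p \<in> paths w"
  shows "od_pair W paths p = w"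
  unfolding od_pair_def
  using assms by (intro the_equality) (auto simp: disjoint_family_on_def)

lemma sum_all_paths:
  assumes "finite W" "\<And>w. w \<in> W \<Longrightarrow> finite (paths w)" "disjoint_family_on paths W"
  shows "(\<Sum>p\<in>all_paths W paths. g p) = (\<Sum>w\<in>W. \<Sum>p\<in>paths w. g p)"
  unfolding all_paths_def
  using assms by (intro sum.UNION_disjoint) (auto simp: disjoint_family_on_def)

theorem corollary3p2:
  fixes t0 tf :: real
    and W :: "('n \<times> 'n) set"
    and paths :: "'n \<times> 'n \<Rightarrow> 'p set"
    and Q :: "'n \<times> 'n \<Rightarrow> real"
    and D :: "('p \<Rightarrow> real \<Rightarrow> real) \<Rightarrow> 'p \<Rightarrow> real \<Rightarrow> real"
    and f :: "real \<Rightarrow> real"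
    and TA :: "'n \<times> 'n \<Rightarrow> real"
    and \<epsilon> :: "'n \<times> 'n \<Rightarrow> real"
    and h\<^sub>s :: "'p \<Rightarrow> real \<Rightarrow> real"
  defines "P \<equiv> all_paths W paths"
    and "\<Lambda> \<equiv> feasible_set t0 tf W paths Q"
    and "\<Psi> \<equiv> effective_delay W paths f TA D"
  assumes time: "t0 \<le> tf"
    and finite_W: "finite W"
    and paths: "\<And>w. w \<in> W \<Longrightarrow> finite (paths w) \<and> paths w \<noteq> {}"
    and disjoint: "disjoint_family_on paths W"
    and demand: "\<And>w. w \<in> W \<Longrightarrow> Q w > 0"
    and penalty: "\<And>x. f x \<ge> 0"
    and D_L2: "\<And>h p. h \<in> \<Lambda> \<Longrightarrow> p \<in> P \<Longrightarrow> D h p \<in> L2_plus t0 tf"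
    and D_cong: "\<And>h k. h \<in> \<Lambda> \<Longrightarrow> k \<in> \<Lambda>
      \<Longrightarrow> (\<And>p. p \<in> P \<Longrightarrow> AE t in lebesgue_on {t0..tf}. h p t = k p t)
      \<Longrightarrow> (\<And>p. p \<in> P \<Longrightarrow> AE t in lebesgue_on {t0..tf}. D h p t = D k p t)"
    and Psi_L2: "\<And>h p. h \<in> \<Lambda> \<Longrightarrow> p \<in> P \<Longrightarrow> \<Psi> h p \<in> L2_plus t0 tf"
    and Psi_pos: "\<And>h p. h \<in> \<Lambda> \<Longrightarrow> p \<in> P \<Longrightarrow> AE t in lebesgue_on {t0..tf}. \<Psi> h p t > 0"
    and Psi_essinf: "\<And>h p. h \<in> \<Lambda> \<Longrightarrow> p \<in> P \<Longrightarrow> essinf (lebesgue_on {t0..tf}) (\<Psi> h p) > 0"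
    and tolerance: "\<And>w. w \<in> W \<Longrightarrow> \<epsilon> w \<ge> 0"
    and feasible: "h\<^sub>s \<in> \<Lambda>"
  shows "BR_DUE t0 tf W paths Q \<Psi> \<epsilon> h\<^sub>s \<longleftrightarrow>
    (\<forall>h\<in>\<Lambda>.
      (\<Sum>p\<in>P. \<integral>t. phi_eps t0 tf W paths \<Psi> \<epsilon> h\<^sub>s p t * (h p t - h\<^sub>s p t)
        \<partial>lebesgue_on {t0..tf}) \<ge> 0)"
proof -
  let ?M = "lebesgue_on {t0..tf}"
  let ?phi = "phi_eps t0 tf W paths \<Psi> \<epsilon> h\<^sub>s"
  define u where "u w = v_od t0 tf paths \<Psi> h\<^sub>s w + \<epsilon> w" for w
  interpret finite_measure ?M
    by (rule finite_measure_lebesgue_on_Icc)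
  have P_I: "p \<in> P" if "w \<in> W" "p \<in> paths w" for p w
    using that by (auto simp: P_def all_paths_def)
  have phi: "?phi p t = max (\<Psi> h\<^sub>s p t) (u w)" if "w \<in> W" "p \<in> paths w" for p w t
    using od_pair_eq[OF disjoint that] by (simp add: phi_eps_def u_def Let_def)
  have Psi_L2': "\<Psi> h\<^sub>s p \<in> L2 t0 tf" if "p \<in> P" for p
    using Psi_L2[OF feasible that] by (simp add: L2_plus_def)
  have Psi_meas: "\<Psi> h\<^sub>s p \<in> borel_measurable ?M" if "p \<in> P" for p
    using Psi_L2'[OF that] by (simp add: L2_def)
  have phi_L2: "?phi p \<in> L2 t0 tf" if "w \<in> W" "p \<in> paths w" for p w
    unfolding phi[OF that, abs_def] using L2_max_const[OF Psi_L2'[OF P_I[OF that]]] .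
  have h_L2: "h p \<in> L2 t0 tf" and h_nonneg: "AE t in ?M. 0 \<le> h p t"
    if "h \<in> \<Lambda>" "w \<in> W" "p \<in> paths w" for h p w
    using that P_I by (auto simp: \<Lambda>_def feasible_set_def P_def L2_plus_def)
  have h_int: "integrable ?M (h p)" if "h \<in> \<Lambda>" "w \<in> W" "p \<in> paths w" for h p w
    using integrable_mult_L2[OF h_L2[OF that] L2_const[of 1]] by simp
  have h_sum: "(\<Sum>p\<in>paths w. \<integral>t. h p t \<partial>?M) = Q w" if "h \<in> \<Lambda>" "w \<in> W" for h w
    using that by (simp add: \<Lambda>_def feasible_set_def)
  have phih_int: "integrable ?M (\<lambda>t. ?phi p t * h p t)" if "h \<in> \<Lambda>" "w \<in> W" "p \<in> paths w" for h p w
    using integrable_mult_L2[OF phi_L2 h_L2] that by blast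
  have gap_int: "integrable ?M (\<lambda>t. (?phi p t - u w) * h p t)" if "h \<in> \<Lambda>" "w \<in> W" "p \<in> paths w" for h p w
    using phih_int[OF that] h_int[OF that] by (simp add: left_diff_distrib)
  have gap_nonneg: "AE t in ?M. 0 \<le> (?phi p t - u w) * h p t" if "h \<in> \<Lambda>" "w \<in> W" "p \<in> paths w" for h p w
    using h_nonneg[OF that] by eventually_elim (simp add: phi[OF that(2,3)])
  \<comment> \<open>The excess over \<open>u w * Q w\<close> of the cost of \<open>h\<close> on the
    pair \<open>w\<close>. Costs are frozen at \<open>h\<^sub>s\<close>, so \<open>gap\<close> is
    linear in \<open>h\<close>.\<close>
  define gap where "gap h w = (\<Sum>p\<in>paths w. \<integral>t. (?phi p t - u w) * h p t \<partial>?M)" for h w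
  have gap_ge0: "gap h w \<ge> 0" if "h \<in> \<Lambda>" "w \<in> W" for h w
    unfolding gap_def using gap_nonneg[OF that] by (intro sum_nonneg integral_nonneg_AE)
  \<comment> \<open>All feasible flows carry the same demand \<open>Q w\<close>, so the term
    \<open>u w * Q w\<close> cancels in the difference and the inequality separates over the
    pairs.\<close>
  have VI_eq: "(\<Sum>p\<in>P. \<integral>t. ?phi p t * (h p t - h\<^sub>s p t) \<partial>?M) = (\<Sum>w\<in>W. gap h w - gap h\<^sub>s w)"
    if h: "h \<in> \<Lambda>" for h
  proof -
    have "(\<Sum>p\<in>paths w. \<integral>t. ?phi p t * (h p t - h\<^sub>s p t) \<partial>?M) = gap h w - gap h\<^sub>s w"
      if w: "w \<in> W" for w
    proof -
      have gap: "gap k w = (\<Sum>p\<in>paths w. \<integral>t. ?phi p t * k p t \<partial>?M) - u w * Q w" if k: "k \<in> \<Lambda>" for k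
      proof -
        have "gap k w = (\<Sum>p\<in>paths w. (\<integral>t. ?phi p t * k p t \<partial>?M) - u w * (\<integral>t. k p t \<partial>?M))"
          unfolding gap_def using phih_int[OF k w] h_int[OF k w]
          by (intro sum.cong) (auto simp: left_diff_distrib)
        then show ?thesis
          using h_sum[OF k w] by (simp add: sum_subtractf flip: sum_distrib_left)
      qed
      have "(\<Sum>p\<in>paths w. \<integral>t. ?phi p t * (h p t - h\<^sub>s p t) \<partial>?M)
          = (\<Sum>p\<in>paths w. (\<integral>t. ?phi p t * h p t \<partial>?M) - (\<integral>t. ?phi p t * h\<^sub>s p t \<partial>?M))"
        using phih_int[OF h w] phih_int[OF feasible w]
        by (intro sum.cong) (auto simp: right_diff_distrib)
      then show ?thesis
        by (simp add: gap[OF h] gap[OF feasible] sum_subtractf)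
    qed
    then show ?thesis
      unfolding P_def using paths by (subst sum_all_paths[OF finite_W _ disjoint]) auto
  qed
  \<comment> \<open>The condition \<open>t0 \<le> tf\<close> admits a one-point interval. On a null
    space all integrals vanish, which contradicts the positive demand of \<open>w\<close>.\<close>
  have M_nonzero: "emeasure ?M (space ?M) \<noteq> 0" if w: "w \<in> W" for w
  proof
    assume "emeasure ?M (space ?M) = 0"
    then have "AE t in ?M. g t = 0" for g :: "real \<Rightarrow> real"
      by (intro AE_I[of _ _ "space ?M"]) auto
    then have "(\<integral>t. g t \<partial>?M) = 0" for g :: "real \<Rightarrow> real"
      by (rule integral_eq_zero_AE)
    then show False
      using h_sum[OF feasible w] demand[OF w] by simp
  qed
  have essinf_v: "essinf ?M (\<Psi> h\<^sub>s p) = ereal (v_path t0 tf \<Psi> h\<^sub>s p)" if "w \<in> W" "p \<in> paths w" for p w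
    unfolding v_path_def
    using essinf_eq_real[OF Psi_essinf[OF feasible] M_nonzero] P_I that by blast
  have v_le: "AE t in ?M. v_od t0 tf paths \<Psi> h\<^sub>s w \<le> \<Psi> h\<^sub>s p t" if "w \<in> W" "p \<in> paths w" for p w
  proof -
    have "v_od t0 tf paths \<Psi> h\<^sub>s w \<le> v_path t0 tf \<Psi> h\<^sub>s p"
      unfolding v_od_def using paths that by (intro Min_le) auto
    moreover have "AE t in ?M. v_path t0 tf \<Psi> h\<^sub>s p \<le> \<Psi> h\<^sub>s p t"
      using essinf_AE_le[of ?M "\<Psi> h\<^sub>s p"] by (simp add: essinf_v[OF that])
    ultimately show ?thesis by auto
  qed
  have BR_iff: "BR_DUE t0 tf W paths Q \<Psi> \<epsilon> h\<^sub>s \<longleftrightarrow> (\<forall>w\<in>W. gap h\<^sub>s w = 0)"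
  proof -
    have "(AE t in ?M. h\<^sub>s p t > 0 \<longrightarrow> \<Psi> h\<^sub>s p t \<in> {v_od t0 tf paths \<Psi> h\<^sub>s w..v_od t0 tf paths \<Psi> h\<^sub>s w + \<epsilon> w})
      \<longleftrightarrow> (\<integral>t. (?phi p t - u w) * h\<^sub>s p t \<partial>?M) = 0" if "w \<in> W" "p \<in> paths w" for w p
    proof -
      have "(\<integral>t. (?phi p t - u w) * h\<^sub>s p t \<partial>?M) = 0 \<longleftrightarrow> (AE t in ?M. (?phi p t - u w) * h\<^sub>s p t = 0)"
        using that feasible by (intro integral_nonneg_eq_0_iff_AE gap_int gap_nonneg)
      \<comment> \<open>Where \<open>h\<^sub>s p t > 0\<close>, the product vanishes iff
        \<open>\<Psi> h\<^sub>s p t \<le> u w\<close>; the lower end of the interval holds almost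
        everywhere by \<open>v_le\<close>. Where the flow is zero, both sides are true.\<close>
      also have "\<dots> \<longleftrightarrow> (AE t in ?M. h\<^sub>s p t > 0 \<longrightarrow>
          \<Psi> h\<^sub>s p t \<in> {v_od t0 tf paths \<Psi> h\<^sub>s w..v_od t0 tf paths \<Psi> h\<^sub>s w + \<epsilon> w})"
        using h_nonneg[OF feasible that] v_le[OF that]
        by (intro eventually_subst, eventually_elim) (auto simp: phi[OF that] u_def max_def)
      finally show ?thesis ..
    qed
    moreover have "gap h\<^sub>s w = 0 \<longleftrightarrow> (\<forall>p\<in>paths w. (\<integral>t. (?phi p t - u w) * h\<^sub>s p t \<partial>?M) = 0)"
      if "w \<in> W" for w
      unfolding gap_def using paths[OF that] gap_nonneg[OF feasible that]
      by (intro sum_nonneg_eq_0_iff integral_nonneg_AE) auto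
    ultimately show ?thesis
      using feasible by (simp add: BR_DUE_def \<Lambda>_def)
  qed
  \<comment> \<open>Only the flow of one pair is rerouted; the other pairs then contribute nothing
    to the inequality, which isolates \<open>gap h\<^sub>s w\<close>.\<close>
  have competitor: "\<exists>h\<in>\<Lambda>. (\<forall>w'\<in>W - {w}. gap h w' = gap h\<^sub>s w') \<and> gap h w \<le> \<delta> * Q w"
    if w: "w \<in> W" and "\<delta> > 0" for w \<delta>
  proof -
    have "v_od t0 tf paths \<Psi> h\<^sub>s w \<in> v_path t0 tf \<Psi> h\<^sub>s ` paths w"
      unfolding v_od_def using paths[OF w] by (intro Min_in) auto
    then obtain q where q: "q \<in> paths w" and v_q: "v_od t0 tf paths \<Psi> h\<^sub>s w = v_path t0 tf \<Psi> h\<^sub>s q"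
      by blast
    \<comment> \<open>The slack \<open>\<delta>\<close> is essential when
      \<open>\<epsilon> w = 0\<close>: the essential infimum on \<open>q\<close> then equals
      \<open>u w\<close>, and the set where the delay is below \<open>u w\<close> is null.\<close>
    define B where "B = {t \<in> space ?M. \<Psi> h\<^sub>s q t < u w + \<delta>}"
    have B: "B \<in> sets ?M"
      unfolding B_def using Psi_meas[OF P_I[OF w q]] by measurable
    have B_pos: "measure ?M B > 0"
      unfolding B_def
    proof (rule measure_sublevel_pos[OF finite_measure_lebesgue_on_Icc Psi_meas[OF P_I[OF w q]]])
      show "essinf ?M (\<Psi> h\<^sub>s q) < ereal (u w + \<delta>)"
        unfolding essinf_v[OF w q] u_def v_q using tolerance[OF w] \<open>\<delta> > 0\<close> by simp
    qed
    \<comment> \<open>The constant rate on \<open>B\<close> whose integral is the whole demand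
      \<open>Q w\<close>.\<close>
    define c where "c = Q w / measure ?M B"
    have c: "c \<ge> 0" "c * measure ?M B = Q w"
      using B_pos demand[OF w] by (auto simp: c_def)
    have c_int: "(\<integral>t. c * indicator B t \<partial>?M) = Q w"
    proof -
      have "B \<inter> space ?M = B"
        using sets.sets_into_space[OF B] by blast
      then show ?thesis
        using c(2) by simp
    qed
    define h where "h r = (if r \<in> paths w then if r = q then (\<lambda>t. c * indicator B t) else (\<lambda>t. 0) else h\<^sub>s r)" for r
    \<comment> \<open>By disjointness, emptying the paths of \<open>w\<close> leaves the paths of
      the other pairs untouched.\<close>
    have h_other: "h r = h\<^sub>s r" if "w' \<in> W" "w' \<noteq> w" "r \<in> paths w'" for r w'
      using disjoint that w by (auto simp: h_def disjoint_family_on_def)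
    have "h \<in> \<Lambda>"
      unfolding \<Lambda>_def feasible_set_def
    proof (intro CollectI conjI ballI)
      fix r assume "r \<in> all_paths W paths"
      then show "h r \<in> L2_plus t0 tf"
        using feasible L2_plus_indicator[OF B c(1)] L2_plus_indicator[OF sets.empty_sets, of 0 t0 tf]
        by (auto simp: h_def \<Lambda>_def feasible_set_def)
    next
      fix w' assume w': "w' \<in> W"
      show "(\<Sum>p\<in>paths w'. \<integral>t. h p t \<partial>?M) = Q w'"
      proof (cases "w' = w")
        case True
        have "(\<Sum>p\<in>paths w. \<integral>t. h p t \<partial>?M) = (\<Sum>p\<in>paths w. if p = q then Q w else 0)"
          using c_int by (intro sum.cong) (simp_all add: h_def)
        then show ?thesis
          using True paths[OF w] q by simp
      next
        case False
        then show ?thesis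
          using h_other[OF w'] h_sum[OF feasible w'] by simp
      qed
    qed
    moreover have "gap h w' = gap h\<^sub>s w'" if "w' \<in> W - {w}" for w'
      unfolding gap_def using that by (intro sum.cong refl) (simp add: h_other[of w'])
    moreover have "gap h w \<le> \<delta> * Q w"
    proof -
      have "gap h w = (\<Sum>p\<in>paths w. if p = q then \<integral>t. (?phi q t - u w) * h q t \<partial>?M else 0)"
        unfolding gap_def by (intro sum.cong) (auto simp: h_def)
      also have "\<dots> = (\<integral>t. (?phi q t - u w) * h q t \<partial>?M)"
        using paths[OF w] q by simp
      also have "\<dots> \<le> (\<integral>t. \<delta> * h q t \<partial>?M)"
      proof (rule integral_mono)
        show "integrable ?M (\<lambda>t. (?phi q t - u w) * h q t)"
          by (rule gap_int[OF \<open>h \<in> \<Lambda>\<close> w q])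
        show "integrable ?M (\<lambda>t. \<delta> * h q t)"
          using h_int[OF \<open>h \<in> \<Lambda>\<close> w q] by simp
        \<comment> \<open>On \<open>B\<close> both \<open>\<Psi> h\<^sub>s q t\<close> and
          \<open>u w\<close> lie below \<open>u w + \<delta>\<close>, hence so does their maximum;
          off \<open>B\<close> the flow \<open>h q\<close> is zero.\<close>
        show "(?phi q t - u w) * h q t \<le> \<delta> * h q t" for t
          using q c(1) \<open>\<delta> > 0\<close>
          by (cases "t \<in> B") (auto simp: h_def phi[OF w q] B_def intro!: mult_right_mono)
      qed
      also have "\<dots> = \<delta> * Q w"
        using q c_int by (simp add: h_def)
      finally show ?thesis .
    qed
    ultimately show ?thesis by blast
  qed
  show ?thesis
    unfolding BR_iff
  proof
    assume "\<forall>w\<in>W. gap h\<^sub>s w = 0"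
    then show "\<forall>h\<in>\<Lambda>. (\<Sum>p\<in>P. \<integral>t. ?phi p t * (h p t - h\<^sub>s p t) \<partial>?M) \<ge> 0"
      by (auto simp: VI_eq gap_ge0 intro!: sum_nonneg)
  next
    assume VI: "\<forall>h\<in>\<Lambda>. (\<Sum>p\<in>P. \<integral>t. ?phi p t * (h p t - h\<^sub>s p t) \<partial>?M) \<ge> 0"
    show "\<forall>w\<in>W. gap h\<^sub>s w = 0"
    proof
      fix w assume w: "w \<in> W"
      have gap_le: "gap h\<^sub>s w \<le> \<delta> * Q w" if "\<delta> > 0" for \<delta>
      proof -
        obtain h where h: "h \<in> \<Lambda>" "\<And>w'. w' \<in> W - {w} \<Longrightarrow> gap h w' = gap h\<^sub>s w'" "gap h w \<le> \<delta> * Q w"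
          using competitor[OF w \<open>\<delta> > 0\<close>] by blast
        have "0 \<le> (\<Sum>w\<in>W. gap h w - gap h\<^sub>s w)"
          using VI h(1) by (simp flip: VI_eq[OF h(1)])
        also have "\<dots> = gap h w - gap h\<^sub>s w"
          using h(2) by (simp add: sum.remove[OF finite_W w])
        finally show ?thesis
          using h(3) by simp
      qed
      \<comment> \<open>The choice \<open>\<delta> = e / Q w\<close> turns the bound
        \<open>\<delta> * Q w\<close> into an arbitrary positive \<open>e\<close>.\<close>
      have "gap h\<^sub>s w \<le> 0 + e" if "e > 0" for e
        using gap_le[of "e / Q w"] demand[OF w] that by simp
      then have "gap h\<^sub>s w \<le> 0"
        by (rule field_le_epsilon)
      then show "gap h\<^sub>s w = 0"
        using gap_ge0[OF feasible w] by simp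
    qed
  qed
qed

end
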